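(* Let $d\ge1$, $\mathcal{A}=\prod_{i=1}^d[a_{\min}^i,a_{\max}^i]$, and $\delta^i>0$ for $i=1,\dots,d$. Fix $a_{\text{prev}}\in\mathcal{A}$ and let $$\mathcal{F}=\{a\in\mathbb{R}^d:\ |a^i-a_{\text{prev}}^i|\le\delta^i\ \text{for all } i\}\cap\mathcal{A}.$$ Let $R^{+,i}=\min(\delta^i,a_{\max}^i-a_{\text{prev}}^i)$ and $R^{-,i}=\min(\delta^i,a_{\text{prev}}^i-a_{\min}^i)$. Let $\mathcal{R}_{\text{DD}}\subseteq\mathbb{R}^d$ be the reachable set of the DD-SRad mapping, i.e. the set of its values as $u$ ranges over $\mathbb{R}^d$ with $a_{\text{prev}}$ fixed. Then its closure satisfies $$\overline{\mathcal{R}_{\text{DD}}}=\prod_{i=1}^d\left[a_{\text{prev}}^i-R^{-,i},\ a_{\text{prev}}^i+R^{+,i}\right]=\mathcal{F},$$ and has Lebesgue measure $V_{\text{DD}}=\prod_{i=1}^d(R^{-,i}+R^{+,i})$. Moreover, away from position boundaries (that is, when $R^{+,i}=R^{-,i}=\delta^i$ for all $i$), the volume ratio relative to the $\ell_2$ spherical parameterization (SRad) with global radius $R=\min_i\delta^i$ is $$\frac{V_{\text{DD}}}{V_{\text{SRad}}}=\frac{2^d\,\Gamma(d/2+1)}{\pi^{d/2}}\cdot\frac{\prod_i\delta^i}{(\min_i\delta^i)^d},$$ where $V_{\text{SRad}}=\frac{\pi^{d/2}}{\Gamma(d/2+1)}(\min_i\delta^i)^d$ is the volume of the $d$-dimensional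 $\ell_2$ ball of radius $\min_i\delta^i$ and $\Gamma$ is the Gamma function.
   Context: Per-dimension effective radius: for $u^i\in\mathbb{R}$ and $a_{\text{prev}}^i\in[a_{\min}^i,a_{\max}^i]$, $$R_{\text{eff}}^i(u^i,a_{\text{prev}}^i)=\begin{cases}\min(\delta^i,\ a_{\max}^i-a_{\text{prev}}^i), & u^i>0,\\ \min(\delta^i,\ a_{\text{prev}}^i-a_{\min}^i), & u^i<0,\\ \delta^i, & u^i=0.\end{cases}$$ DD-SRad mapping: given $u\in\mathbb{R}^d$ and $a_{\text{prev}}\in\mathcal{A}$, the output $a\in\mathbb{R}^d$ is defined coordinatewise by $$a^i=a_{\text{prev}}^i+R_{\text{eff}}^i(u^i,a_{\text{prev}}^i)\cdot\frac{u^i}{\sqrt{1+(u^i)^2}},\qquad i=1,\dots,d.$$ The SRad parameterization with center $c$ and radius $R>0$ is the map $u\mapsto c+R\,u/\sqrt{1+\|u\|_2^2}$ on $\mathbb{R}^d$; its reachable set is the open $\ell_2$ ball of radius $R$ about $c$. *)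

theory Defs
  imports "HOL-Analysis.Analysis"
begin

definition R_eff :: "real \<Rightarrow> real \<Rightarrow> real \<Rightarrow> real \<Rightarrow> real \<Rightarrow> real" where
  "R_eff \<delta> amin amax u aprev =
     (if u > 0 then min \<delta> (amax - aprev)
      else if u < 0 then min \<delta> (aprev - amin)
      else \<delta>)"

definition dd_srad ::
  "real^'d \<Rightarrow> real^'d \<Rightarrow> real^'d \<Rightarrow> real^'d \<Rightarrow> real^'d \<Rightarrow> real^'d" where
  "dd_srad \<delta> amin amax aprev u =
     (\<chi> i. aprev $ i
        + R_eff (\<delta> $ i) (amin $ i) (amax $ i) (u $ i) (aprev $ i)
          * (u $ i / sqrt (1 + (u $ i)\<^sup>2)))"

definition dd_reachable ::
  "real^'d \<Rightarrow> real^'d \<Rightarrow> real^'d \<Rightarrow> real^'d \<Rightarrow> (real^'d) set" where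
  "dd_reachable \<delta> amin amax aprev = range (dd_srad \<delta> amin amax aprev)"

text \<open>On \<^typ>\<open>real^'d\<close>, \<^const>\<open>norm\<close> is the Euclidean norm
  and \<^const>\<open>cbox\<close> the coordinatewise product of closed intervals.\<close>

definition srad :: "real^'d \<Rightarrow> real \<Rightarrow> real^'d \<Rightarrow> real^'d" where
  "srad c R u = c + (R / sqrt (1 + (norm u)\<^sup>2)) *\<^sub>R u"

definition srad_reachable :: "real^'d \<Rightarrow> real \<Rightarrow> (real^'d) set" where
  "srad_reachable c R = range (srad c R)"

definition feasible ::
  "real^'d \<Rightarrow> real^'d \<Rightarrow> real^'d \<Rightarrow> real^'d \<Rightarrow> (real^'d) set" where
  "feasible \<delta> amin amax aprev =
     {a. \<forall>i. \<bar>a $ i - aprev $ i\<bar> \<le> \<delta> $ i} \<inter> cbox amin amax"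

definition R_plus :: "real^'d \<Rightarrow> real^'d \<Rightarrow> real^'d \<Rightarrow> real^'d" where
  "R_plus \<delta> amax aprev = (\<chi> i. min (\<delta> $ i) (amax $ i - aprev $ i))"

definition R_minus :: "real^'d \<Rightarrow> real^'d \<Rightarrow> real^'d \<Rightarrow> real^'d" where
  "R_minus \<delta> amin aprev = (\<chi> i. min (\<delta> $ i) (aprev $ i - amin $ i))"

definition min_radius :: "real^'d \<Rightarrow> real" where
  "min_radius \<delta> = Min (range (\<lambda>i. \<delta> $ i))"

end

theory Submission
  imports Defs
begin

text \<open>
  The profile \<open>u / sqrt (1 + |u|\<^sup>2)\<close> maps a normed space onto its open unit ball, with inverse
  \<open>t / sqrt (1 - |t|\<^sup>2)\<close>. On \<open>real^'d\<close> this makes the SRad reachable set an open Euclidean ball. On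
  \<open>real\<close> it makes every coordinate of the DD-SRad displacement range over the interval from \<open>-R\<^sup>-\<close>
  to \<open>R\<^sup>+\<close> without its nonzero end points. Hence every proper shrinking of a point of the closed
  box towards \<open>aprev\<close> is reachable, and the box is the closure.
\<close>

lemma range_srad_profile:
  "range (\<lambda>u::'a::real_normed_vector. (1 / sqrt (1 + (norm u)\<^sup>2)) *\<^sub>R u) = ball 0 1"
proof (intro set_eqI iffI)
  fix t :: 'a
  assume "t \<in> range (\<lambda>u. (1 / sqrt (1 + (norm u)\<^sup>2)) *\<^sub>R u)"
  then obtain u where t: "t = (1 / sqrt (1 + (norm u)\<^sup>2)) *\<^sub>R u" by auto
  have "norm u < sqrt (1 + (norm u)\<^sup>2)" by (rule real_less_rsqrt) simp
  moreover have "0 < sqrt (1 + (norm u)\<^sup>2)" by (simp add: add_pos_nonneg)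
  ultimately show "t \<in> ball 0 1" unfolding t by simp
next
  fix t :: 'a
  assume "t \<in> ball 0 1"
  then have pos: "1 - (norm t)\<^sup>2 > 0" by (simp add: power_less_one_iff abs_square_less_1)
  define u where "u = (1 / sqrt (1 - (norm t)\<^sup>2)) *\<^sub>R t"
  \<comment> \<open>Hence the normalising factor of \<open>u\<close> is
    \<open>sqrt (1 - (norm t)^2)\<close>, which cancels the factor in the definition of
    \<open>u\<close>.\<close>
  have "1 + (norm u)\<^sup>2 = 1 / (1 - (norm t)\<^sup>2)"
    using pos by (simp add: u_def power_mult_distrib power_divide field_simps)
  then have "(1 / sqrt (1 + (norm u)\<^sup>2)) *\<^sub>R u = t"
    using pos by (simp add: u_def real_sqrt_divide)
  then show "t \<in> range (\<lambda>u. (1 / sqrt (1 + (norm u)\<^sup>2)) *\<^sub>R u)" by (rule range_eqI[OF sym])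
qed

lemma srad_profile_abs_less_1: "\<bar>u / sqrt (1 + u\<^sup>2)\<bar> < (1::real)"
  using rangeI[of "\<lambda>u::real. (1 / sqrt (1 + (norm u)\<^sup>2)) *\<^sub>R u" u]
  unfolding range_srad_profile by simp

lemma srad_profile_surj:
  assumes "\<bar>t\<bar> < (1::real)"
  obtains u where "u / sqrt (1 + u\<^sup>2) = t"
proof -
  have "t \<in> range (\<lambda>u::real. (1 / sqrt (1 + (norm u)\<^sup>2)) *\<^sub>R u)"
    unfolding range_srad_profile using assms by simp
  then show thesis using that by auto
qed

lemma srad_reachable_eq_ball:
  assumes "R > 0"
  shows "srad_reachable c R = ball c R"
proof -
  have "srad c R = (\<lambda>t. c + t) \<circ> (\<lambda>t. R *\<^sub>R t) \<circ> (\<lambda>u. (1 / sqrt (1 + (norm u)\<^sup>2)) *\<^sub>R u)"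
    by (auto simp: srad_def)
  then have "srad_reachable c R = (\<lambda>t. c + t) ` (\<lambda>t. R *\<^sub>R t) ` ball 0 1"
    unfolding srad_reachable_def range_srad_profile[symmetric] by (simp only: image_comp comp_assoc)
  also have "\<dots> = ball c R" using assms by (simp add: ball_scale ball_translation)
  finally show ?thesis .
qed

text \<open>The profile has the sign of \<open>u\<close> and modulus below 1, so the product stays
  between 0 and the signed radius that \<open>R_eff\<close> selects for that sign. Both radii are
  nonnegative because \<open>p\<close> lies between \<open>amin\<close> and \<open>amax\<close>, so
  0 always belongs to the interval.\<close>

lemma R_eff_profile_bounds:
  assumes "\<delta> > 0" "amin \<le> p" "p \<le> amax"
  shows "R_eff \<delta> amin amax u p * (u / sqrt (1 + u\<^sup>2))
           \<in> {- min \<delta> (p - amin) .. min \<delta> (amax - p)}"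
proof -
  let ?t = "u / sqrt (1 + u\<^sup>2)"
  have abs: "?t \<le> 1" "- 1 \<le> ?t"
    using srad_profile_abs_less_1[of u] by linarith+
  let ?m = "min \<delta> (p - amin)" and ?M = "min \<delta> (amax - p)"
  have nonneg: "0 \<le> ?m" "0 \<le> ?M" using assms by auto
  consider "u > 0" | "u < 0" | "u = 0" by linarith
  then show ?thesis
  proof cases
    case 1
    then have "0 \<le> ?M * ?t" using nonneg by (intro mult_nonneg_nonneg) auto
    moreover have "?M * ?t \<le> ?M" using abs(1) nonneg(2) by (rule mult_left_le)
    moreover have "R_eff \<delta> amin amax u p = ?M" using 1 by (simp add: R_eff_def)
    ultimately show ?thesis using nonneg by (simp only: atLeastAtMost_iff, intro conjI TrueI; linarith)
  next
    case 2
    then have "?t \<le> 0" by (simp add: divide_nonpos_pos add_pos_nonneg)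
    then have "?m * ?t \<le> 0" using nonneg by (intro mult_nonneg_nonpos)
    moreover have "- ?m \<le> ?m * ?t" using mult_left_mono[OF abs(2) nonneg(1)] by simp
    moreover have "R_eff \<delta> amin amax u p = ?m" using 2 by (simp add: R_eff_def)
    ultimately show ?thesis using nonneg by (simp only: atLeastAtMost_iff, intro conjI TrueI; linarith)
  next
    case 3
    with assms show ?thesis by simp
  qed
qed

text \<open>The alternatives \<open>y = 0\<close> cover a previous action on a position boundary:
  there one radius is 0 and no strict inequality holds at 0, yet \<open>u = 0\<close> still attains
  it. For \<open>y\<close> nonzero, the strict bound on its side forces the radius there to be
  positive, so dividing by it gives an admissible profile value.\<close>

lemma R_eff_profile_surj:
  assumes "- min \<delta> (p - amin) < y \<or> y = 0" "y < min \<delta> (amax - p) \<or> y = 0"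
  obtains u where "R_eff \<delta> amin amax u p * (u / sqrt (1 + u\<^sup>2)) = y"
proof (cases y "0::real" rule: linorder_cases)
  case equal
  then show thesis using that[of 0] by simp
next
  case greater
  define r where "r = min \<delta> (amax - p)"
  have r: "0 < y" "y < r" using greater assms by (auto simp: r_def)
  then have "\<bar>y / r\<bar> < 1" by (simp add: abs_if divide_simps)
  then obtain u where u: "u / sqrt (1 + u\<^sup>2) = y / r" by (rule srad_profile_surj)
  \<comment> \<open>The sign of \<open>u\<close> is read off from the profile value; it ensures that
    \<open>R_eff\<close> selects the very radius \<open>r\<close> used in the division.\<close>
  have "0 < u / sqrt (1 + u\<^sup>2)" using r by (simp only: u) simp
  moreover have "0 < 1 + u\<^sup>2" by (simp add: add_pos_nonneg)
  ultimately have "u > 0" by (auto simp: zero_less_divide_iff)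
  then show thesis
    using r by (intro that[of u]) (simp only: u, simp add: R_eff_def flip: r_def)
next
  case less
  define r where "r = min \<delta> (p - amin)"
  have r: "y < 0" "- y < r" using less assms by (auto simp: r_def)
  then have "\<bar>y / r\<bar> < 1" by (simp add: abs_if divide_simps)
  then obtain u where u: "u / sqrt (1 + u\<^sup>2) = y / r" by (rule srad_profile_surj)
  have "u / sqrt (1 + u\<^sup>2) < 0" using r by (simp only: u) (simp add: divide_neg_pos)
  moreover have "0 < 1 + u\<^sup>2" by (simp add: add_pos_nonneg)
  ultimately have "u < 0" by (auto simp: divide_less_0_iff)
  then show thesis
    using r by (intro that[of u]) (simp only: u, simp add: R_eff_def flip: r_def)
qed

text \<open>Coordinatewise, \<open>p - min d (p - l) = max (p - d) l\<close> and
  \<open>p + min d (h - p) = min (p + d) h\<close>: the box is the intersection of the rate and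
  position intervals.\<close>

lemma cbox_R_minus_R_plus_eq_feasible:
  "cbox (aprev - R_minus \<delta> amin aprev) (aprev + R_plus \<delta> amax aprev) = feasible \<delta> amin amax aprev"
proof -
  have "p - min d (p - l) \<le> x \<and> x \<le> p + min d (h - p) \<longleftrightarrow> \<bar>x - p\<bar> \<le> d \<and> l \<le> x \<and> x \<le> h"
    for p d l h x :: real by (auto simp: min_def)
  then show ?thesis
    by (auto simp: feasible_def R_minus_def R_plus_def mem_box_cart)
qed

lemma closure_dd_reachable:
  fixes amin amax \<delta> aprev :: "real^'d"
  assumes pos: "\<forall>i. \<delta> $ i > 0" and mem: "aprev \<in> cbox amin amax"
  shows "closure (dd_reachable \<delta> amin amax aprev)
           = cbox (aprev - R_minus \<delta> amin aprev) (aprev + R_plus \<delta> amax aprev)" (is "_ = ?B")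
proof
  show "closure (dd_reachable \<delta> amin amax aprev) \<subseteq> ?B"
  proof (rule closure_minimal)
    show "dd_reachable \<delta> amin amax aprev \<subseteq> ?B"
      using R_eff_profile_bounds pos mem
      by (fastforce simp: dd_reachable_def dd_srad_def R_minus_def R_plus_def mem_box_cart
          simp del: times_divide_eq_right)
  qed (rule closed_cbox)
next
  show "?B \<subseteq> closure (dd_reachable \<delta> amin amax aprev)"
  proof
    fix x assume x: "x \<in> ?B"
    \<comment> \<open>The factors lie in [0, 1) and tend to 1; at \<open>n = 0\<close> the factor is
      0 and the point is \<open>aprev\<close>.\<close>
    define z where "z n = aprev + (1 - inverse (real (Suc n))) *\<^sub>R (x - aprev)" for n
    have "z n \<in> dd_reachable \<delta> amin amax aprev" for n
    proof -
      define s where "s = 1 - inverse (real (Suc n))"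
      have s: "0 \<le> s" "s < 1" by (auto simp: s_def field_simps)
      \<comment> \<open>Shrinking makes a weak bound strict, except that the value 0 may meet a
        radius \<open>r = 0\<close>.\<close>
      have scale: "s * y < r \<or> s * y = 0" if "y \<le> r" "0 \<le> r" for y r
      proof (cases "y \<le> 0")
        case True
        then have "s * y \<le> 0" using s by (simp add: mult_nonneg_nonpos)
        with that show ?thesis by linarith
      next
        case False
        then have "s * y < y" using s by simp
        with that show ?thesis by linarith
      qed
      have "\<exists>u. R_eff (\<delta> $ i) (amin $ i) (amax $ i) u (aprev $ i) * (u / sqrt (1 + u\<^sup>2))
              = s * (x $ i - aprev $ i)" for i
      proof -
        let ?y = "x $ i - aprev $ i"
        have "amin $ i \<le> aprev $ i" "aprev $ i \<le> amax $ i" "\<delta> $ i > 0"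
          using pos mem by (auto simp: mem_box_cart)
        moreover have "?y \<le> min (\<delta> $ i) (amax $ i - aprev $ i)"
          and "- ?y \<le> min (\<delta> $ i) (aprev $ i - amin $ i)"
          using x[unfolded R_minus_def R_plus_def mem_box_cart, THEN spec, of i]
          by (simp_all add: algebra_simps del: min_less_iff_conj min.bounded_iff)
        \<comment> \<open>The lower bound is the upper bound for the reflected displacement
          \<open>- ?y\<close>.\<close>
        ultimately have hi: "s * ?y < min (\<delta> $ i) (amax $ i - aprev $ i) \<or> s * ?y = 0"
          and "s * (- ?y) < min (\<delta> $ i) (aprev $ i - amin $ i) \<or> s * (- ?y) = 0"
          by (intro scale; simp)+
        from this(2) have lo: "- min (\<delta> $ i) (aprev $ i - amin $ i) < s * ?y \<or> s * ?y = 0"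
          by linarith
        show ?thesis by (rule R_eff_profile_surj[OF lo hi]) blast
      qed
      \<comment> \<open>Each coordinate of \<open>dd_srad\<close> depends only on the same
        coordinate of the input, so the inputs can be chosen separately and assembled into one
        vector.\<close>
      then obtain u where
        "\<And>i. R_eff (\<delta> $ i) (amin $ i) (amax $ i) (u i) (aprev $ i) * (u i / sqrt (1 + (u i)\<^sup>2))
              = s * (x $ i - aprev $ i)"
        by metis
      then have "z n = dd_srad \<delta> amin amax aprev (\<chi> i. u i)"
        by (simp add: vec_eq_iff dd_srad_def z_def s_def del: of_nat_Suc times_divide_eq_right)
      then show ?thesis by (auto simp: dd_reachable_def)
    qed
    moreover have "z \<longlonglongrightarrow> aprev + (1 - 0) *\<^sub>R (x - aprev)"
      unfolding z_def by (intro tendsto_intros LIMSEQ_inverse_real_of_nat)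
    ultimately show "x \<in> closure (dd_reachable \<delta> amin amax aprev)"
      unfolding closure_sequential by auto
  qed
qed

lemma min_radius_pos:
  assumes "\<forall>i. \<delta> $ i > 0"
  shows "min_radius \<delta> > 0"
  using assms by (simp add: min_radius_def)

text \<open>Membership in \<open>lmeasurable\<close> is stated separately because
  \<open>measure\<close> also returns 0 on non-measurable sets and on sets of infinite measure. The
  centre \<open>c\<close> is arbitrary, as the volume of a ball does not depend on it.\<close>

theorem theorem2p7:
  fixes amin amax \<delta> aprev :: "real^'d"
  assumes "\<forall>i. \<delta> $ i > 0"
    and "aprev \<in> cbox amin amax"
  shows
    "closure (dd_reachable \<delta> amin amax aprev)
        = cbox (aprev - R_minus \<delta> amin aprev) (aprev + R_plus \<delta> amax aprev)
     \<and> cbox (aprev - R_minus \<delta> amin aprev) (aprev + R_plus \<delta> amax aprev)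
        = feasible \<delta> amin amax aprev
     \<and> closure (dd_reachable \<delta> amin amax aprev) \<in> lmeasurable
     \<and> measure lebesgue (closure (dd_reachable \<delta> amin amax aprev))
        = (\<Prod>i\<in>UNIV. R_minus \<delta> amin aprev $ i + R_plus \<delta> amax aprev $ i)
     \<and> (\<forall>c :: real^'d.
          measure lebesgue (srad_reachable c (min_radius \<delta>))
            = measure lebesgue (ball c (min_radius \<delta>))
        \<and> measure lebesgue (ball c (min_radius \<delta>))
            = pi powr (real CARD('d) / 2) / Gamma (real CARD('d) / 2 + 1)
              * min_radius \<delta> ^ CARD('d)
        \<and> ((\<forall>i. R_plus \<delta> amax aprev $ i = \<delta> $ i \<and> R_minus \<delta> amin aprev $ i = \<delta> $ i) \<longrightarrow>
            measure lebesgue (closure (dd_reachable \<delta> amin amax aprev))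
              / measure lebesgue (srad_reachable c (min_radius \<delta>))
            = 2 ^ CARD('d) * Gamma (real CARD('d) / 2 + 1) / pi powr (real CARD('d) / 2)
              * ((\<Prod>i\<in>UNIV. \<delta> $ i) / min_radius \<delta> ^ CARD('d))))"
proof -
  let ?R = "min_radius \<delta>"
  let ?B = "cbox (aprev - R_minus \<delta> amin aprev) (aprev + R_plus \<delta> amax aprev)"
  let ?V = "\<Prod>i\<in>UNIV. R_minus \<delta> amin aprev $ i + R_plus \<delta> amax aprev $ i"
  have R: "?R > 0" using assms(1) by (rule min_radius_pos)
  have cl: "closure (dd_reachable \<delta> amin amax aprev) = ?B"
    using assms by (rule closure_dd_reachable)
  \<comment> \<open>Nonnegative radii put \<open>aprev\<close> into the box; the product formula for
    the volume requires a nonempty box.\<close>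
  have "0 \<le> R_minus \<delta> amin aprev $ i" "0 \<le> R_plus \<delta> amax aprev $ i" for i
    using assms by (auto simp: R_minus_def R_plus_def mem_box_cart less_imp_le)
  then have "aprev \<in> ?B" by (simp add: mem_box_cart)
  then have "?B \<noteq> {}" by blast
  then have vol: "measure lebesgue ?B = ?V"
    by (simp add: content_cbox_cart algebra_simps)
  have ball: "measure lebesgue (ball c ?R)
      = pi powr (real CARD('d) / 2) / Gamma (real CARD('d) / 2 + 1) * ?R ^ CARD('d)" for c :: "real^'d"
    using R by (simp add: content_ball unit_ball_vol_def)
  have ratio: "measure lebesgue ?B / measure lebesgue (ball c ?R)
      = 2 ^ CARD('d) * Gamma (real CARD('d) / 2 + 1) / pi powr (real CARD('d) / 2)
              * ((\<Prod>i\<in>UNIV. \<delta> $ i) / ?R ^ CARD('d))"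
    if "\<forall>i. R_plus \<delta> amax aprev $ i = \<delta> $ i \<and> R_minus \<delta> amin aprev $ i = \<delta> $ i" for c :: "real^'d"
  proof -
    \<comment> \<open>Away from the position boundaries every side has length
      \<open>2 * \<delta> $ i\<close>, the source of the factor \<open>2 ^ CARD('d)\<close>.\<close>
    have "?V = (\<Prod>i\<in>UNIV. 2 * \<delta> $ i)" using that by simp
    also have "\<dots> = 2 ^ CARD('d) * (\<Prod>i\<in>UNIV. \<delta> $ i)" by (simp add: prod.distrib)
    finally show ?thesis unfolding vol ball by (simp add: ac_simps)
  qed
  show ?thesis
    unfolding cl srad_reachable_eq_ball[OF R]
    by (intro conjI allI impI refl cbox_R_minus_R_plus_eq_feasible lmeasurable_cbox vol ball ratio) auto
qed

end
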